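(* Let $\mathcal A\subset\mathbb{C}$ be a finite set and let $b\in\mathcal A^{\mathbb{Z}}$. If for all $\mathfrak a\in\mathcal A$ the constant sequence $\boldsymbol{\mathfrak a}$ belongs to $X_b$, then $$\overline{W(A_b)}=\mathrm{conv}\Bigl(\bigcup_{\mathfrak a\in\mathcal A}\overline{W(A_{\boldsymbol{\mathfrak a}})}\Bigr)=\mathrm{conv}\Bigl(\bigcup_{\mathfrak a\in\mathcal A}\sigma(A_{\boldsymbol{\mathfrak a}})\Bigr).$$
   Context: For $b=(b_i)_{i\in\mathbb{Z}}\in\mathcal A^{\mathbb{Z}}$, $A_b\colon \ell^2(\mathbb{Z})\to\ell^2(\mathbb{Z})$ (complex scalars) denotes the bounded tridiagonal operator $(A_bx)_k=b_{k-1}x_{k-1}+x_{k+1}$ for $k\in\mathbb{Z}$. For $\mathfrak a\in\mathcal A$, $\boldsymbol{\mathfrak a}$ is the constant biinfinite sequence with all entries $\mathfrak a$. The numerical range of an operator $A$ is $W(A)=\{\langle Ax,x\rangle : x\in\ell^2(\mathbb{Z}),\ \|x\|=1\}$, where $\langle x,y\rangle=\sum_{k}x_k\overline{y_k}$; $\sigma(A)$ is the spectrum of $A$; $\mathrm{conv}$ denotes the convex hull, and $\overline{S}$ the closure of $S$. The shift map $\varphi$ on $\mathcal A^{\mathbb{Z}}$ is $\varphi(b)_i=b_{i+1}$; $\mathrm{orb}(b)=\{\varphi^n(b):n\in\mathbb{Z}\}$; the subshift generated by $b$ is $X_b=\overline{\mathrm{orb}(b)}$, the closure in $\mathcal A^{\mathbb{Z}}$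 with the product topology of the discrete topology on $\mathcal A$ (equivalently, two sequences are close when they agree on a long central block of coordinates $[-k,k]$). *)

theory Defs
  imports "HOL-Analysis.Analysis"
begin

section \<open>The Hilbert space of square-summable biinfinite sequences\<close>

text \<open>
  Square-summable sequences form a subset of the type \<^typ>\<open>int \<Rightarrow> complex\<close>. An operator
  on them is a map of that type into itself of which only the values on \<open>ell2\<close> matter.
\<close>

definition ell2 :: "(int \<Rightarrow> complex) set" where
  "ell2 = {x. (\<lambda>k. (cmod (x k))\<^sup>2) summable_on UNIV}"

definition ell2_inner :: "(int \<Rightarrow> complex) \<Rightarrow> (int \<Rightarrow> complex) \<Rightarrow> complex" where
  "ell2_inner x y = (\<Sum>\<^sub>\<infinity>k. x k * cnj (y k))"

definition ell2_norm :: "(int \<Rightarrow> complex) \<Rightarrow> real" where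
  "ell2_norm x = sqrt (\<Sum>\<^sub>\<infinity>k. (cmod (x k))\<^sup>2)"

definition bounded_operator :: "((int \<Rightarrow> complex) \<Rightarrow> (int \<Rightarrow> complex)) \<Rightarrow> bool" where
  "bounded_operator T \<longleftrightarrow>
     (\<forall>x\<in>ell2. T x \<in> ell2) \<and>
     (\<forall>x\<in>ell2. \<forall>y\<in>ell2. T (\<lambda>k. x k + y k) = (\<lambda>k. T x k + T y k)) \<and>
     (\<forall>c. \<forall>x\<in>ell2. T (\<lambda>k. c * x k) = (\<lambda>k. c * T x k)) \<and>
     (\<exists>C. \<forall>x\<in>ell2. ell2_norm (T x) \<le> C * ell2_norm x)"

definition numerical_range :: "((int \<Rightarrow> complex) \<Rightarrow> (int \<Rightarrow> complex)) \<Rightarrow> complex set" where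
  "numerical_range T = {ell2_inner (T x) x | x. x \<in> ell2 \<and> ell2_norm x = 1}"

text \<open>The scalars \<open>z\<close> for which \<open>T - z I\<close> has no bounded two-sided inverse \<open>R\<close> on \<open>ell2\<close>.\<close>

definition spectrum :: "((int \<Rightarrow> complex) \<Rightarrow> (int \<Rightarrow> complex)) \<Rightarrow> complex set" where
  "spectrum T = {z. \<not> (\<exists>R. bounded_operator R \<and>
     (\<forall>x\<in>ell2. R (\<lambda>k. T x k - z * x k) = x) \<and>
     (\<forall>x\<in>ell2. (\<lambda>k. T (R x) k - z * R x k) = x))}"

section \<open>The tridiagonal operator\<close>

definition tridiag :: "(int \<Rightarrow> complex) \<Rightarrow> (int \<Rightarrow> complex) \<Rightarrow> (int \<Rightarrow> complex)" where
  "tridiag b x = (\<lambda>k. b (k - 1) * x (k - 1) + x (k + 1))"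

lemma ell2_translate:
  assumes "x \<in> ell2"
  shows "(\<lambda>k. x (k + n)) \<in> ell2" "ell2_norm (\<lambda>k. x (k + n)) = ell2_norm x"
proof -
  have bij: "bij_betw (\<lambda>k::int. k + n) UNIV UNIV"
    by (rule bij_betwI[where g = "\<lambda>k. k - n"]) auto
  show "(\<lambda>k. x (k + n)) \<in> ell2"
    using assms summable_on_reindex_bij_betw[OF bij, of "\<lambda>k. (cmod (x k))\<^sup>2"]
    by (simp add: ell2_def)
  show "ell2_norm (\<lambda>k. x (k + n)) = ell2_norm x"
    using infsum_reindex_bij_betw[OF bij, of "\<lambda>k. (cmod (x k))\<^sup>2"]
    by (simp add: ell2_norm_def)
qed

lemma bounded_operator_tridiag:
  assumes "bounded (range b)"
  shows "bounded_operator (tridiag b)"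
proof -
  obtain M where M: "cmod (b k) \<le> M" for k
    using assms by (auto simp: bounded_iff)
  have M0: "0 \<le> M" using M[of 0] norm_ge_zero order_trans by blast
  define C where "C = 2 * (M\<^sup>2 + 1)"
  have main: "tridiag b x \<in> ell2 \<and> ell2_norm (tridiag b x) \<le> sqrt C * ell2_norm x"
    if x: "x \<in> ell2" for x
  proof -
    let ?f = "\<lambda>k. 2 * M\<^sup>2 * (cmod (x (k + (-1))))\<^sup>2 + 2 * (cmod (x (k + 1)))\<^sup>2"
    have le: "(cmod (tridiag b x k))\<^sup>2 \<le> ?f k" for k
    proof -
      have "cmod (tridiag b x k) \<le> M * cmod (x (k - 1)) + cmod (x (k + 1))"
        unfolding tridiag_def
        by (rule order_trans[OF norm_triangle_ineq])
           (simp add: norm_mult mult_right_mono M)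
      then have "(cmod (tridiag b x k))\<^sup>2 \<le> (M * cmod (x (k - 1)) + cmod (x (k + 1)))\<^sup>2"
        by (rule power_mono) simp
      also have "\<dots> \<le> 2 * (M * cmod (x (k - 1)))\<^sup>2 + 2 * (cmod (x (k + 1)))\<^sup>2"
        using zero_le_power2[of "M * cmod (x (k - 1)) - cmod (x (k + 1))"]
        unfolding power2_sum power2_diff by linarith
      finally show ?thesis by (simp add: power_mult_distrib)
    qed
    have s: "(\<lambda>k. (cmod (x (k + n)))\<^sup>2) summable_on UNIV" for n
      using ell2_translate(1)[OF x, of n] by (simp add: ell2_def)
    have i: "(\<Sum>\<^sub>\<infinity>k. (cmod (x (k + n)))\<^sup>2) = (\<Sum>\<^sub>\<infinity>k. (cmod (x k))\<^sup>2)" for n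
      using ell2_translate(2)[OF x, of n] by (simp add: ell2_norm_def)
    have sf: "?f summable_on UNIV"
      by (intro summable_on_add summable_on_cmult_right s)
    have st: "(\<lambda>k. (cmod (tridiag b x k))\<^sup>2) summable_on UNIV"
      by (rule summable_on_comparison_test[OF sf]) (use le in auto)
    have "(\<Sum>\<^sub>\<infinity>k. (cmod (tridiag b x k))\<^sup>2) \<le> infsum ?f UNIV"
      by (rule infsum_mono[OF st sf]) (use le in auto)
    also have "\<dots> = (\<Sum>\<^sub>\<infinity>k. 2 * M\<^sup>2 * (cmod (x (k + (-1))))\<^sup>2) + (\<Sum>\<^sub>\<infinity>k. 2 * (cmod (x (k + 1)))\<^sup>2)"
      by (intro infsum_add summable_on_cmult_right s)
    also have "\<dots> = C * (\<Sum>\<^sub>\<infinity>k. (cmod (x k))\<^sup>2)"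
      unfolding infsum_cmult_right' i C_def by (simp add: algebra_simps)
    finally show ?thesis
      using st by (simp add: ell2_def ell2_norm_def flip: real_sqrt_mult)
  qed
  have "\<exists>C. \<forall>x\<in>ell2. ell2_norm (tridiag b x) \<le> C * ell2_norm x"
    using main by (intro exI[of _ "sqrt C"]) simp
  moreover have "tridiag b (\<lambda>k. x k + y k) = (\<lambda>k. tridiag b x k + tridiag b y k)"
    "tridiag b (\<lambda>k. c * x k) = (\<lambda>k. c * tridiag b x k)" for x y c
    by (auto simp: tridiag_def algebra_simps)
  ultimately show ?thesis
    unfolding bounded_operator_def using main by simp
qed

section \<open>The subshift generated by a sequence\<close>

definition shift :: "(int \<Rightarrow> 'a) \<Rightarrow> (int \<Rightarrow> 'a)" where
  "shift b = (\<lambda>i. b (i + 1))"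

definition orb :: "(int \<Rightarrow> 'a) \<Rightarrow> (int \<Rightarrow> 'a) set" where
  "orb b = range (\<lambda>n. (shift ^^ n) b) \<union> range (\<lambda>n. (inv shift ^^ n) b)"

lemma orb_eq: "orb b = range (\<lambda>n i. b (i + n))"
proof -
  have inv: "inv shift = (\<lambda>(b :: int \<Rightarrow> 'a) i. b (i - 1))"
    by (rule inv_equality) (auto simp: shift_def)
  have p: "(shift ^^ n) b = (\<lambda>i. b (i + int n))" for n
    by (induction n) (auto simp: shift_def algebra_simps)
  have m: "(inv shift ^^ n) b = (\<lambda>i. b (i - int n))" for n
    by (induction n) (auto simp: inv algebra_simps)
  have "\<exists>m. n = int m \<or> n = - int m" for n
    by (metis int_cases2)
  then show ?thesis
    unfolding orb_def p m by (auto simp: image_iff fun_eq_iff) (metis add_uminus_conv_diff)+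
qed

definition subshift :: "'a set \<Rightarrow> (int \<Rightarrow> 'a) \<Rightarrow> (int \<Rightarrow> 'a) set" where
  "subshift A b = product_topology (\<lambda>_. discrete_topology A) UNIV closure_of orb b"

end

theory Submission
  imports Defs
begin

text \<open>
  All three sets equal the convex hull \<open>K\<close> of the curves
  \<open>E\<^sub>a = {z + a * cnj z | \<bar>z\<bar> = 1}\<close> with \<open>a \<in> A\<close>, the ranges of the symbols of the constant
  operators.

  The quadratic form of the operator is a sum over edges \<open>{k, k + 1}\<close>. Writing the product
  \<open>x\<^sub>k * cnj x\<^bsub>k+1\<^esub>\<close> in polar form shows that the contribution of an edge is
  \<open>\<bar>x\<^sub>k\<bar> \<bar>x\<^bsub>k+1\<^esub>\<bar>\<close> times a point of the curve belonging to \<open>b\<^sub>k\<close>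
  (\<open>edge_in_symbol_curve\<close>). For a unit vector these weights have sum at most one, and \<open>0 \<in> K\<close>
  because each curve is symmetric about the origin. Hence every value of the form lies in the
  compact convex set \<open>K\<close> (\<open>closure_numerical_range_subset\<close>).

  For the converse, a constant sequence in the subshift means that \<open>b\<close> contains arbitrarily long
  blocks of that constant, and each long block contains a long block far from the origin. Plane
  waves cut off to such blocks show that each point of \<open>E\<^sub>a\<close> is a limit of values of the form
  at unit vectors supported arbitrarily far out. The set of all such limits is convex, since two
  vectors whose supports are not adjacent do not interact
  (\<open>convex_form_values_at_infinity\<close>); this replaces the Toeplitz--Hausdorff theorem. A constant
  \<open>b\<close> is the special case \<open>A = {a}\<close>, so the first equation of the theorem amounts to the fact
  that the hull of a union of hulls is the hull of the union.

  It remains to see that \<open>E\<^sub>a\<close> is the spectrum of the constant operator. With the shift \<open>S\<close>, the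
  operator minus \<open>w\<close> is \<open>S\<inverse> (S - l) (S - m)\<close>, where \<open>l + m = w\<close> and \<open>l m = a\<close>. A
  root of modulus one exists precisely when \<open>w \<in> E\<^sub>a\<close>; otherwise both factors are inverted by
  Neumann series. For \<open>w \<in> E\<^sub>a\<close>, truncated plane waves are approximate eigenvectors.
\<close>

section \<open>Square-summable sequences\<close>

text \<open>
  Every estimate below is made on finite sets of coordinates; the next two lemmas translate
  between such estimates and the norm.
\<close>

lemma ell2_of_finite_sums:
  assumes "\<And>F. finite F \<Longrightarrow> (\<Sum>k\<in>F. (cmod (x k))\<^sup>2) \<le> B"
  shows "x \<in> ell2" "(ell2_norm x)\<^sup>2 \<le> B"
proof -
  have s: "(\<lambda>k. (cmod (x k))\<^sup>2) summable_on UNIV"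
    by (rule nonneg_bdd_above_summable_on) (auto intro!: bdd_aboveI2 assms)
  then show "x \<in> ell2" by (simp add: ell2_def)
  have "(\<Sum>\<^sub>\<infinity>k. (cmod (x k))\<^sup>2) \<le> B"
    by (rule infsum_le_finite_sums[OF s]) (use assms in auto)
  then show "(ell2_norm x)\<^sup>2 \<le> B"
    by (simp add: ell2_norm_def infsum_nonneg)
qed

lemma finite_sum_le_ell2_norm:
  assumes "x \<in> ell2" "finite F"
  shows "(\<Sum>k\<in>F. (cmod (x k))\<^sup>2) \<le> (ell2_norm x)\<^sup>2"
proof -
  have "(\<Sum>k\<in>F. (cmod (x k))\<^sup>2) \<le> (\<Sum>\<^sub>\<infinity>k. (cmod (x k))\<^sup>2)"
    by (rule finite_sum_le_infsum) (use assms in \<open>auto simp: ell2_def\<close>)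
  then show ?thesis by (simp add: ell2_norm_def infsum_nonneg)
qed

lemma cmod_le_ell2_norm:
  assumes "x \<in> ell2"
  shows "cmod (x k) \<le> ell2_norm x"
  using finite_sum_le_ell2_norm[OF assms, of "{k}"]
  by (auto simp: ell2_norm_def infsum_nonneg intro: power2_le_imp_le)

lemma finitely_supported_ell2:
  assumes "finite F" "\<And>k. k \<notin> F \<Longrightarrow> x k = 0"
  shows "x \<in> ell2" "(ell2_norm x)\<^sup>2 = (\<Sum>k\<in>F. (cmod (x k))\<^sup>2)"
proof -
  have "((\<lambda>k. (cmod (x k))\<^sup>2) has_sum (\<Sum>k\<in>F. (cmod (x k))\<^sup>2)) UNIV"
    by (rule has_sum_finite_neutralI) (use assms in auto)
  then show "x \<in> ell2" "(ell2_norm x)\<^sup>2 = (\<Sum>k\<in>F. (cmod (x k))\<^sup>2)"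
    by (auto simp: ell2_def ell2_norm_def infsumI has_sum_imp_summable sum_nonneg)
qed

section \<open>The quadratic form as a sum over edges\<close>

text \<open>
  The part of the quadratic form of the tridiagonal operator that couples the
  neighbouring coordinates \<open>k\<close> and \<open>k + 1\<close>.
\<close>

definition edge :: "(int \<Rightarrow> complex) \<Rightarrow> (int \<Rightarrow> complex) \<Rightarrow> int \<Rightarrow> complex" where
  "edge b x k = b k * (x k * cnj (x (k + 1))) + x (k + 1) * cnj (x k)"

lemma finite_sum_neighbours_le:
  assumes "x \<in> ell2" "finite F"
  shows "(\<Sum>k\<in>F. cmod (x k * cnj (x (k + 1)))) \<le> (ell2_norm x)\<^sup>2"
proof -
  have "cmod (x k * cnj (x (k + 1))) \<le> ((cmod (x k))\<^sup>2 + (cmod (x (k + 1)))\<^sup>2) / 2" for k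
    using zero_le_power2[of "cmod (x k) - cmod (x (k + 1))"]
    by (simp add: norm_mult power2_diff)
  then have "(\<Sum>k\<in>F. cmod (x k * cnj (x (k + 1))))
      \<le> (\<Sum>k\<in>F. ((cmod (x k))\<^sup>2 + (cmod (x (k + 1)))\<^sup>2) / 2)"
    by (rule sum_mono)
  also have "\<dots> = ((\<Sum>k\<in>F. (cmod (x k))\<^sup>2) + (\<Sum>k\<in>F. (cmod (x (k + 1)))\<^sup>2)) / 2"
    by (simp add: sum.distrib flip: sum_divide_distrib)
  also have "\<dots> \<le> (ell2_norm x)\<^sup>2"
    using finite_sum_le_ell2_norm[OF assms]
      finite_sum_le_ell2_norm[OF ell2_translate(1)[OF assms(1), of 1] assms(2)]
      ell2_translate(2)[OF assms(1), of 1]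
    by simp
  finally show ?thesis .
qed

text \<open>
  Both halves of the form converge absolutely, so shifting the index of the subdiagonal half
  by one is legitimate; it collects the two terms that belong to the same edge.
\<close>

lemma inner_tridiag_has_sum:
  assumes b: "bounded (range b)" and x: "x \<in> ell2"
  shows "(edge b x has_sum ell2_inner (tridiag b x) x) UNIV"
proof -
  obtain M where M: "cmod (b k) \<le> M" for k
    using b by (auto simp: bounded_iff)
  have p: "(\<lambda>k. norm (x k * cnj (x (k + 1)))) summable_on UNIV"
    by (rule nonneg_bdd_above_summable_on)
       (auto intro!: bdd_aboveI2 finite_sum_neighbours_le[OF x])
  have q: "(\<lambda>k. x (k + 1) * cnj (x k)) summable_on UNIV"
    by (rule abs_summable_summable, rule summable_on_cong[THEN iffD1, OF _ p])
       (simp add: norm_mult mult.commute)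
  have r: "(\<lambda>k. b k * (x k * cnj (x (k + 1)))) summable_on UNIV"
    by (rule abs_summable_summable,
        rule summable_on_comparison_test[OF summable_on_cmult_right[OF p, of M]])
       (auto simp: norm_mult M intro!: mult_right_mono)
  have bij: "bij_betw (\<lambda>k::int. k - 1) UNIV UNIV"
    by (rule bij_betwI[where g = "\<lambda>k. k + 1"]) auto
  have r': "((\<lambda>k. b (k - 1) * (x (k - 1) * cnj (x k)))
      has_sum (\<Sum>\<^sub>\<infinity>k. b k * (x k * cnj (x (k + 1))))) UNIV"
    using has_sum_reindex_bij_betw[OF bij, of "\<lambda>k. b k * (x k * cnj (x (k + 1)))"]
      has_sum_infsum[OF r] by simp
  have "((\<lambda>k. tridiag b x k * cnj (x k))
      has_sum (\<Sum>\<^sub>\<infinity>k. b k * (x k * cnj (x (k + 1)))) + (\<Sum>\<^sub>\<infinity>k. x (k + 1) * cnj (x k))) UNIV"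
    using has_sum_add[OF r' has_sum_infsum[OF q]] by (simp add: tridiag_def algebra_simps)
  then have "ell2_inner (tridiag b x) x
      = (\<Sum>\<^sub>\<infinity>k. b k * (x k * cnj (x (k + 1)))) + (\<Sum>\<^sub>\<infinity>k. x (k + 1) * cnj (x k))"
    by (simp add: ell2_inner_def infsumI)
  then show ?thesis
    using has_sum_add[OF has_sum_infsum[OF r] has_sum_infsum[OF q]]
    by (simp add: edge_def[abs_def])
qed

section \<open>Symbol curves and the upper bound for the numerical range\<close>

text \<open>
  The curve traced on the unit circle by the symbol \<open>z + a z\<inverse>\<close> of the Laurent operator
  with constant sequence \<open>a\<close>; it is an ellipse, possibly degenerate.
\<close>

definition symbol_curve :: "complex \<Rightarrow> complex set" where
  "symbol_curve a = (\<lambda>z. z + a * cnj z) ` sphere 0 1"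

lemma compact_symbol_curve: "compact (symbol_curve a)"
  unfolding symbol_curve_def
  by (intro compact_continuous_image continuous_intros compact_sphere)

lemma zero_in_hull_symbol_curve: "0 \<in> convex hull symbol_curve a"
proof -
  have "1 + a \<in> symbol_curve a"
    unfolding symbol_curve_def by (rule rev_image_eqI[of 1]) auto
  moreover have "- (1 + a) \<in> symbol_curve a"
    unfolding symbol_curve_def by (rule rev_image_eqI[of "- 1"]) auto
  ultimately have "(1/2) *\<^sub>R (1 + a) + (1/2) *\<^sub>R (- (1 + a)) \<in> convex hull symbol_curve a"
    by (intro convexD[OF convex_convex_hull]) (auto intro: hull_inc)
  then show ?thesis by (simp add: scaleR_right_diff_distrib scaleR_add_right)
qed

text \<open>
  Write \<open>x\<^sub>k * cnj x\<^bsub>k+1\<^esub> = r * cnj u\<close> in polar form: the edge term becomes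
  \<open>r * (u + b\<^sub>k * cnj u)\<close>.
\<close>

lemma edge_in_symbol_curve:
  "\<exists>w\<in>symbol_curve (b k). edge b x k = cmod (x k * cnj (x (k + 1))) *\<^sub>R w"
proof -
  define p where "p = x k * cnj (x (k + 1))"
  obtain u where u: "cmod u = 1" "p = cmod p *\<^sub>R cnj u"
  proof (cases "p = 0")
    case True
    then show ?thesis using that[of 1] by simp
  next
    case False
    then show ?thesis using that[of "cnj (sgn p)"]
      by (simp add: norm_sgn sgn_div_norm)
  qed
  have "edge b x k = b k * p + cnj p"
    by (simp add: edge_def p_def mult.commute)
  also have "\<dots> = cmod p *\<^sub>R (u + b k * cnj u)"
    by (subst (1 2) u(2)) (simp add: algebra_simps scaleR_conv_of_real)
  finally show ?thesis
    using u(1) unfolding p_def symbol_curve_def by (auto simp: dist_norm)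
qed

lemma subconvex_sum_in_convex:
  fixes w :: "'i \<Rightarrow> 'a::real_vector"
  assumes "convex K" "0 \<in> K" "finite F"
    and "\<And>i. i \<in> F \<Longrightarrow> 0 \<le> c i" "sum c F \<le> 1" "\<And>i. i \<in> F \<Longrightarrow> w i \<in> K"
  shows "(\<Sum>i\<in>F. c i *\<^sub>R w i) \<in> K"
proof (cases "sum c F = 0")
  case True
  then have "\<forall>i\<in>F. c i = 0"
    using assms by (simp add: sum_nonneg_eq_0_iff)
  then show ?thesis using assms(2) by simp
next
  case False
  define s where "s = sum c F"
  have s: "0 < s" "s \<le> 1"
    using False assms sum_nonneg[of F c] by (auto simp: s_def)
  have "(\<Sum>i\<in>F. (c i / s) *\<^sub>R w i) \<in> K"
    by (rule convex_sum) (use assms s in \<open>auto simp: s_def simp flip: sum_divide_distrib\<close>)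
  then have "s *\<^sub>R (\<Sum>i\<in>F. (c i / s) *\<^sub>R w i) + (1 - s) *\<^sub>R 0 \<in> K"
    using assms s by (intro convexD) auto
  then show ?thesis
    using s by (simp add: scaleR_sum_right)
qed

text \<open>
  For a unit vector the form is an infinite combination of points of the symbol curves whose
  weights \<open>\<bar>x\<^sub>k\<bar> \<bar>x\<^bsub>k+1\<^esub>\<bar>\<close> add up to at most one; the missing mass is put on the
  point \<open>0\<close>, and compactness of the hull gives the passage to the limit.
\<close>

lemma closure_numerical_range_subset:
  assumes A: "finite A" and b: "range b \<subseteq> A"
  shows "closure (numerical_range (tridiag b)) \<subseteq> convex hull (\<Union>a\<in>A. symbol_curve a)"
proof -
  let ?K = "convex hull (\<Union>a\<in>A. symbol_curve a)"
  have bb: "bounded (range b)"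
    using finite_imp_bounded[OF A] b bounded_subset by blast
  have closed: "closed ?K"
    by (intro compact_imp_closed compact_convex_hull compact_UN A compact_symbol_curve ballI)
  have "symbol_curve (b 0) \<subseteq> (\<Union>a\<in>A. symbol_curve a)"
    using b by blast
  then have zero: "0 \<in> ?K"
    using zero_in_hull_symbol_curve hull_mono by blast
  have "ell2_inner (tridiag b x) x \<in> ?K" if x: "x \<in> ell2" "ell2_norm x = 1" for x
  proof -
    obtain w where w: "w k \<in> symbol_curve (b k)"
      "edge b x k = cmod (x k * cnj (x (k + 1))) *\<^sub>R w k" for k
      using edge_in_symbol_curve[of b _ x] by metis
    have wK: "w k \<in> ?K" for k
      using w(1)[of k] b by (intro hull_inc) blast
    have "sum (edge b x) F \<in> ?K" if "finite F" for F
      unfolding w(2)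
      by (rule subconvex_sum_in_convex)
         (use finite_sum_neighbours_le[OF x(1) that] x(2) zero wK that in
           \<open>auto simp: convex_convex_hull\<close>)
    then have "\<forall>\<^sub>F F in finite_subsets_at_top UNIV. sum (edge b x) F \<in> ?K"
      by (auto intro: eventually_finite_subsets_at_top_weakI)
    then show ?thesis
      using inner_tridiag_has_sum[OF bb x(1)] unfolding has_sum_def
      by (intro Lim_in_closed_set[OF closed]) auto
  qed
  then show ?thesis
    by (intro closure_minimal closed) (auto simp: numerical_range_def)
qed

section \<open>Values of the form at infinity\<close>

text \<open>
  Limits of values of the quadratic form along unit vectors that leave every finite interval.
  The supports are required to be finite so that a second vector can be placed beyond the first.
\<close>

definition form_values_at_infinity :: "(int \<Rightarrow> complex) \<Rightarrow> complex set" where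
  "form_values_at_infinity b = {w. \<forall>N. \<forall>e>0. \<exists>x. finite {k. x k \<noteq> 0} \<and>
     (\<forall>k. \<bar>k\<bar> \<le> N \<longrightarrow> x k = 0) \<and> ell2_norm x = 1 \<and>
     dist (ell2_inner (tridiag b x) x) w < e}"

lemma form_values_at_infinity_subset:
  "form_values_at_infinity b \<subseteq> closure (numerical_range (tridiag b))"
proof
  fix w assume w: "w \<in> form_values_at_infinity b"
  have "\<exists>y\<in>numerical_range (tridiag b). dist y w < e" if "e > 0" for e
  proof -
    obtain x where x: "finite {k. x k \<noteq> 0}" "ell2_norm x = 1"
        "dist (ell2_inner (tridiag b x) x) w < e"
      using w \<open>e > 0\<close> unfolding form_values_at_infinity_def by blast
    moreover have "x \<in> ell2"
      by (rule finitely_supported_ell2(1)[OF x(1)]) simp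
    ultimately show ?thesis
      unfolding numerical_range_def by blast
  qed
  then show "w \<in> closure (numerical_range (tridiag b))"
    by (simp add: closure_approachable)
qed

text \<open>
  Let \<open>x\<close> be an approximating vector for \<open>v\<close>, and choose the one for \<open>w\<close>, called \<open>y\<close>, beyond the
  support of \<open>x\<close> with a gap. No edge meets both supports, so norm and form are additive on
  \<open>sqrt s * x + sqrt t * y\<close>.
\<close>

lemma convex_form_values_at_infinity:
  assumes b: "bounded (range b)"
  shows "convex (form_values_at_infinity b)"
proof (rule convexI)
  fix v w :: complex and s t :: real
  assume v: "v \<in> form_values_at_infinity b" and w: "w \<in> form_values_at_infinity b"
    and st: "0 \<le> s" "0 \<le> t" "s + t = 1"
  let ?q = "\<lambda>x. ell2_inner (tridiag b x) x"
  show "s *\<^sub>R v + t *\<^sub>R w \<in> form_values_at_infinity b"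
    unfolding form_values_at_infinity_def
  proof (intro CollectI allI impI)
    fix N :: int and e :: real
    assume e: "e > 0"
    obtain x where x: "finite {k. x k \<noteq> 0}" "\<And>k. \<bar>k\<bar> \<le> N \<Longrightarrow> x k = 0"
        "ell2_norm x = 1" "dist (?q x) v < e"
      using v e unfolding form_values_at_infinity_def by blast
    obtain M where M: "\<And>k. x k \<noteq> 0 \<Longrightarrow> \<bar>k\<bar> \<le> M"
    proof
      show "\<bar>k\<bar> \<le> Max (abs ` {k. x k \<noteq> 0})" if "x k \<noteq> 0" for k
        using that x(1) by (intro Max_ge) auto
    qed
    obtain y where y: "finite {k. y k \<noteq> 0}" "\<And>k. \<bar>k\<bar> \<le> max N (M + 1) \<Longrightarrow> y k = 0"
        "ell2_norm y = 1" "dist (?q y) w < e"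
      using w e unfolding form_values_at_infinity_def by blast
    \<comment> \<open>The bound \<open>M + 1\<close> also keeps the supports from being adjacent, so no edge joins them.\<close>
    have sep: "x k = 0 \<or> y j = 0" if "\<bar>j - k\<bar> \<le> 1" for j k
      using M[of k] y(2)[of j] that by fastforce
    have l2: "x \<in> ell2" "y \<in> ell2"
      by (rule finitely_supported_ell2(1)[OF x(1)], simp,
          rule finitely_supported_ell2(1)[OF y(1)], simp)
    define u where "u = (\<lambda>k. sqrt s * x k + sqrt t * y k)"
    have fin: "finite {k. u k \<noteq> 0}"
      by (rule finite_subset[OF _ finite_UnI[OF x(1) y(1)]]) (auto simp: u_def)
    then have u2: "u \<in> ell2"
      by (rule finitely_supported_ell2(1)) simp
    have nx: "((\<lambda>k. (cmod (x k))\<^sup>2) has_sum 1) UNIV" "((\<lambda>k. (cmod (y k))\<^sup>2) has_sum 1) UNIV"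
      using l2 x(3) y(3) by (auto simp: ell2_def ell2_norm_def dest: has_sum_infsum)
    have "(cmod (u k))\<^sup>2 = s * (cmod (x k))\<^sup>2 + t * (cmod (y k))\<^sup>2" for k
      using sep[of k k] st by (auto simp: u_def norm_mult power_mult_distrib)
    then have "((\<lambda>k. (cmod (u k))\<^sup>2) has_sum (s * 1 + t * 1)) UNIV"
      using has_sum_add[OF has_sum_cmult_right[OF nx(1), of s] has_sum_cmult_right[OF nx(2), of t]]
      by simp
    then have nu: "ell2_norm u = 1"
      using st by (simp add: ell2_norm_def infsumI)
    have "edge b u k = s *\<^sub>R edge b x k + t *\<^sub>R edge b y k" for k
    proof -
      have sq: "complex_of_real (sqrt r) * complex_of_real (sqrt r) = complex_of_real r"
        if "0 \<le> r" for r
        using that by (simp flip: of_real_mult)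
      have "edge b u k = (complex_of_real (sqrt s) * complex_of_real (sqrt s)) * edge b x k
          + (complex_of_real (sqrt t) * complex_of_real (sqrt t)) * edge b y k"
        using sep[of k k] sep[of k "k+1"] sep[of "k+1" k] sep[of "k+1" "k+1"]
        unfolding edge_def u_def by (auto simp: algebra_simps)
      then show ?thesis
        using st by (simp add: sq scaleR_conv_of_real)
    qed
    then have "edge b u = (\<lambda>k. s *\<^sub>R edge b x k + t *\<^sub>R edge b y k)"
      by (rule ext)
    then have "(edge b u has_sum (s *\<^sub>R ?q x + t *\<^sub>R ?q y)) UNIV"
      by (simp add: has_sum_add has_sum_scaleR inner_tridiag_has_sum b l2)
    then have q: "?q u = s *\<^sub>R ?q x + t *\<^sub>R ?q y"
      using inner_tridiag_has_sum[OF b u2] has_sum_unique by blast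
    have "?q u - (s *\<^sub>R v + t *\<^sub>R w) = s *\<^sub>R (?q x - v) + t *\<^sub>R (?q y - w)"
      by (simp add: q algebra_simps)
    also have "norm \<dots> \<le> s * norm (?q x - v) + t * norm (?q y - w)"
      using norm_triangle_ineq[of "s *\<^sub>R (?q x - v)" "t *\<^sub>R (?q y - w)"] st by simp
    also have "\<dots> < e"
      by (rule convex_bound_lt) (use x(4) y(4) st in \<open>auto simp: dist_norm\<close>)
    finally have "dist (?q u) (s *\<^sub>R v + t *\<^sub>R w) < e"
      by (simp add: dist_norm)
    moreover have "\<forall>k. \<bar>k\<bar> \<le> N \<longrightarrow> u k = 0"
      using x(2) y(2) by (simp add: u_def)
    ultimately show "\<exists>x. finite {k. x k \<noteq> 0} \<and> (\<forall>k. \<bar>k\<bar> \<le> N \<longrightarrow> x k = 0) \<and>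
        ell2_norm x = 1 \<and> dist (?q x) (s *\<^sub>R v + t *\<^sub>R w) < e"
      using fin nu by blast
  qed
qed

text \<open>
  Agreement with the constant sequence on the coordinates \<open>[-m, m]\<close> defines a neighbourhood of
  it, which must contain a translate of \<open>b\<close>.
\<close>

lemma long_block_of_constant_in_subshift:
  assumes "(\<lambda>_. a) \<in> subshift A b"
  shows "\<exists>n. \<forall>i. \<bar>i\<bar> \<le> m \<longrightarrow> b (i + n) = a"
proof -
  let ?X = "product_topology (\<lambda>_::int. discrete_topology A) UNIV"
  let ?U = "PiE UNIV (\<lambda>i::int. if \<bar>i\<bar> \<le> m then {a} else A)"
  have cl: "(\<lambda>_. a) \<in> ?X closure_of orb b"
    using assms by (simp add: subshift_def)
  then have "(\<lambda>_. a) \<in> topspace ?X"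
    by (simp add: in_closure_of)
  then have a: "a \<in> A" by (simp add: PiE_iff)
  have "finite {i::int. \<bar>i\<bar> \<le> m}"
    by (rule finite_subset[of _ "{-m..m}"]) auto
  then have "openin ?X ?U"
    using a by (intro product_topology_basis) (auto elim!: rev_finite_subset)
  moreover have "(\<lambda>_. a) \<in> ?U" using a by auto
  ultimately obtain y where "y \<in> orb b" "y \<in> ?U"
    using cl by (auto simp: in_closure_of)
  then show ?thesis
    unfolding orb_eq by (auto simp: PiE_iff split: if_splits)
qed

text \<open>
  On \<open>n\<close> consecutive places where \<open>b\<close> equals \<open>a\<close>, the normalised plane wave
  \<open>z\<^sup>k / sqrt n\<close> has \<open>n - 1\<close> inner edges, each of which contributes \<open>(z + a * cnj z) / n\<close>;
  the relative error \<open>1 / n\<close> comes from the cut-off.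
\<close>

lemma symbol_curve_subset_form_values_at_infinity:
  assumes b: "bounded (range b)"
    and blocks: "\<And>m. \<exists>n. \<forall>i. \<bar>i\<bar> \<le> m \<longrightarrow> b (i + n) = a"
  shows "symbol_curve a \<subseteq> form_values_at_infinity b"
proof
  fix w assume "w \<in> symbol_curve a"
  then obtain z where z: "cmod z = 1" and w: "w = z + a * cnj z"
    by (auto simp: symbol_curve_def)
  have z0: "z \<noteq> 0" using z by auto
  show "w \<in> form_values_at_infinity b"
    unfolding form_values_at_infinity_def
  proof (intro CollectI allI impI)
    fix N :: int and e :: real
    assume e: "e > 0"
    obtain n :: nat where n: "cmod w / e < real n" 
      using reals_Archimedean2 by blast
    have n0: "0 < n"
      using n e by (cases n) (auto simp: divide_less_0_iff)
    obtain c where c: "\<And>i. \<bar>i\<bar> \<le> \<bar>N\<bar> + int n + 1 \<Longrightarrow> b (i + c) = a"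
      using blocks by blast
    \<comment> \<open>One of the two ends of the block, the one pointing away from the origin,
      contains an interval of length \<open>n\<close> disjoint from \<open>[-N, N]\<close>.\<close>
    define l where "l = (if c \<ge> 0 then c + \<bar>N\<bar> + 1 else c - \<bar>N\<bar> - int n)"
    have bl: "b k = a" if "l \<le> k" "k < l + int n" for k
      using c[of "k - c"] that by (auto simp: l_def split: if_splits)
    have out: "\<bar>k\<bar> > N" if "l \<le> k" "k < l + int n" for k
      using that by (auto simp: l_def split: if_splits)
    let ?I = "{l..<l + int n}"
    define x where "x = (\<lambda>k. if k \<in> ?I then z powi k / sqrt (real n) else 0)"
    have fin: "finite {k. x k \<noteq> 0}"
      by (rule finite_subset[of _ ?I]) (auto simp: x_def)
    have "x k = 0" if "k \<notin> ?I" for k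
      using that by (auto simp: x_def)
    note x2 = finitely_supported_ell2[of ?I x, OF finite_atLeastLessThan_int this]
    have "(\<Sum>k\<in>?I. (cmod (x k))\<^sup>2) = (\<Sum>k\<in>?I. 1 / real n)"
      by (rule sum.cong) (auto simp: x_def norm_divide norm_power_int z power_divide)
    then have "(ell2_norm x)\<^sup>2 = 1" using x2(2) n0 by simp
    then have nx: "ell2_norm x = 1"
      by (simp add: ell2_norm_def infsum_nonneg)
    let ?J = "{l..<l + int n - 1}"
    have ed: "edge b x k = w / of_nat n" if "k \<in> ?J" for k
    proof -
      have "z powi k * cnj (z powi k) = 1"
        unfolding complex_norm_square[symmetric] by (simp add: norm_power_int z)
      then have "z powi k * cnj (z powi (k + 1)) = cnj z" "z powi (k + 1) * cnj (z powi k) = z"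
        using z0 by (auto simp: power_int_add algebra_simps)
      moreover have "complex_of_real (sqrt n) * complex_of_real (sqrt n) = of_nat n"
        by (simp flip: of_real_mult)
      ultimately show ?thesis
        using that bl[of k] by (simp add: edge_def x_def w add_divide_distrib)
    qed
    have "(edge b x has_sum sum (edge b x) ?J) UNIV"
      by (rule has_sum_finite_neutralI[where B = ?J]) (auto simp: edge_def x_def)
    also have "sum (edge b x) ?J = (\<Sum>k\<in>?J. w / of_nat n)"
      by (rule sum.cong) (auto simp: ed)
    also have "\<dots> = w - w / of_nat n"
      using n0 by (simp add: of_nat_diff field_simps)
    finally have "ell2_inner (tridiag b x) x = w - w / of_nat n"
      using inner_tridiag_has_sum[OF b x2(1)] has_sum_unique by blast
    then have "dist (ell2_inner (tridiag b x) x) w = cmod w / n"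
      by (simp add: dist_norm norm_divide)
    also have "\<dots> < e"
      using n n0 e by (simp add: field_simps)
    finally have "dist (ell2_inner (tridiag b x) x) w < e" .
    moreover have "\<forall>k. \<bar>k\<bar> \<le> N \<longrightarrow> x k = 0"
      using out by (force simp: x_def)
    ultimately show "\<exists>x. finite {k. x k \<noteq> 0} \<and> (\<forall>k. \<bar>k\<bar> \<le> N \<longrightarrow> x k = 0) \<and>
        ell2_norm x = 1 \<and> dist (ell2_inner (tridiag b x) x) w < e"
      using fin nx by blast
  qed
qed

lemma closure_numerical_range_eq:
  assumes A: "finite A" and b: "range b \<subseteq> A"
    and blocks: "\<And>a m. a \<in> A \<Longrightarrow> \<exists>n. \<forall>i. \<bar>i\<bar> \<le> m \<longrightarrow> b (i + n) = a"
  shows "closure (numerical_range (tridiag b)) = convex hull (\<Union>a\<in>A. symbol_curve a)"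
proof
  show "closure (numerical_range (tridiag b)) \<subseteq> convex hull (\<Union>a\<in>A. symbol_curve a)"
    by (rule closure_numerical_range_subset[OF A b])
  have bb: "bounded (range b)"
    using finite_imp_bounded[OF A] b bounded_subset by blast
  have "convex hull (\<Union>a\<in>A. symbol_curve a) \<subseteq> form_values_at_infinity b"
    by (intro hull_minimal UN_least convex_form_values_at_infinity[where b = b]
        symbol_curve_subset_form_values_at_infinity bb blocks)
  then show "convex hull (\<Union>a\<in>A. symbol_curve a) \<subseteq> closure (numerical_range (tridiag b))"
    using form_values_at_infinity_subset by blast
qed

section \<open>The spectrum of the Laurent operators\<close>

text \<open>
  Invertibility as it occurs, negated, in the definition of the spectrum; isolating it allows
  inverses to be composed factor by factor.
\<close>

definition ell2_invertible :: "((int \<Rightarrow> complex) \<Rightarrow> (int \<Rightarrow> complex)) \<Rightarrow> bool" where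
  "ell2_invertible T \<longleftrightarrow> (\<exists>R. bounded_operator R \<and>
     (\<forall>x\<in>ell2. R (T x) = x) \<and> (\<forall>x\<in>ell2. T (R x) = x))"

lemma spectrum_iff_not_invertible:
  "z \<in> spectrum T \<longleftrightarrow> \<not> ell2_invertible (\<lambda>x k. T x k - z * x k)"
  by (simp add: spectrum_def ell2_invertible_def)

lemma bounded_operator_comp:
  assumes R: "bounded_operator R" and S: "bounded_operator S"
  shows "bounded_operator (R \<circ> S)"
proof -
  obtain C where C: "\<And>x. x \<in> ell2 \<Longrightarrow> ell2_norm (R x) \<le> C * ell2_norm x"
    using R unfolding bounded_operator_def by blast
  obtain D where D: "\<And>x. x \<in> ell2 \<Longrightarrow> ell2_norm (S x) \<le> D * ell2_norm x"
    using S unfolding bounded_operator_def by blast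
  have "ell2_norm (R (S x)) \<le> (\<bar>C\<bar> * D) * ell2_norm x" if x: "x \<in> ell2" for x
  proof -
    have Sx: "S x \<in> ell2" using S x by (simp add: bounded_operator_def)
    have "ell2_norm (R (S x)) \<le> C * ell2_norm (S x)" by (rule C[OF Sx])
    also have "\<dots> \<le> \<bar>C\<bar> * ell2_norm (S x)"
      by (rule mult_right_mono) (auto simp: ell2_norm_def infsum_nonneg)
    also have "\<dots> \<le> \<bar>C\<bar> * (D * ell2_norm x)"
      by (rule mult_left_mono) (use D x in auto)
    finally show ?thesis by (simp add: mult.assoc)
  qed
  then have "\<exists>C. \<forall>x\<in>ell2. ell2_norm ((R \<circ> S) x) \<le> C * ell2_norm x"
    by auto
  then show ?thesis
    using R S unfolding bounded_operator_def by simp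
qed

lemma ell2_invertible_comp:
  assumes T: "ell2_invertible T" "\<And>x. x \<in> ell2 \<Longrightarrow> T x \<in> ell2"
    and U: "ell2_invertible U" "\<And>x. x \<in> ell2 \<Longrightarrow> U x \<in> ell2"
  shows "ell2_invertible (\<lambda>x. T (U x))"
proof -
  obtain R where R: "bounded_operator R" "\<forall>x\<in>ell2. R (T x) = x" "\<forall>x\<in>ell2. T (R x) = x"
    using T(1) by (auto simp: ell2_invertible_def)
  obtain S where S: "bounded_operator S" "\<forall>x\<in>ell2. S (U x) = x" "\<forall>x\<in>ell2. U (S x) = x"
    using U(1) by (auto simp: ell2_invertible_def)
  have "R x \<in> ell2" if "x \<in> ell2" for x
    using R(1) that by (simp add: bounded_operator_def)
  then show ?thesis
    unfolding ell2_invertible_def using R S T(2) U(2)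
    by (intro exI[of _ "S \<circ> R"]) (simp add: bounded_operator_comp)
qed

lemma bounded_operator_translate: "bounded_operator (\<lambda>x k. x (k + n))"
  unfolding bounded_operator_def
  by (auto simp: ell2_translate intro!: exI[of _ 1])

lemma ell2_invertible_translate: "ell2_invertible (\<lambda>x k. x (k + n))"
  unfolding ell2_invertible_def
  by (rule exI[of _ "\<lambda>x k. x (k + (- n))"]) (use bounded_operator_translate[of "- n"] in simp)

lemma ell2_scale:
  assumes "x \<in> ell2"
  shows "(\<lambda>k. c * x k) \<in> ell2" "ell2_norm (\<lambda>k. c * x k) = cmod c * ell2_norm x"
  using assms
  by (auto simp: ell2_def ell2_norm_def norm_mult power_mult_distrib infsum_cmult_right'
      real_sqrt_mult intro: summable_on_cmult_right)

lemma ell2_invertible_scale: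
  assumes "c \<noteq> 0"
  shows "ell2_invertible (\<lambda>x k. c * x k)"
proof -
  have "bounded_operator (\<lambda>x k. inverse c * x k)"
    unfolding bounded_operator_def
    by (auto simp: ell2_scale distrib_left mult.left_commute intro!: exI[of _ "cmod (inverse c)"])
  then show ?thesis
    unfolding ell2_invertible_def
    by (intro exI[of _ "\<lambda>x k. inverse c * x k"]) (use assms in \<open>simp flip: mult.assoc\<close>)
qed

lemma ell2_diff_translate:
  assumes "x \<in> ell2"
  shows "(\<lambda>k. x k - c * x (k + n)) \<in> ell2"
proof (rule ell2_of_finite_sums(1))
  fix F :: "int set" assume F: "finite F"
  have *: "(cmod (u - v))\<^sup>2 \<le> 2 * (cmod u)\<^sup>2 + 2 * (cmod v)\<^sup>2" for u v
  proof -
    have "(cmod (u - v))\<^sup>2 \<le> (cmod u + cmod v)\<^sup>2"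
      by (rule power_mono) (auto intro: norm_triangle_ineq4)
    then show ?thesis
      using zero_le_power2[of "cmod u - cmod v"] by (simp add: power2_sum power2_diff)
  qed
  have y: "(\<lambda>k. c * x (k + n)) \<in> ell2"
    using ell2_scale(1)[OF ell2_translate(1)[OF assms]] .
  have "(\<Sum>k\<in>F. (cmod (x k - c * x (k + n)))\<^sup>2)
      \<le> (\<Sum>k\<in>F. 2 * (cmod (x k))\<^sup>2 + 2 * (cmod (c * x (k + n)))\<^sup>2)"
    by (rule sum_mono) (rule *)
  also have "\<dots> = 2 * (\<Sum>k\<in>F. (cmod (x k))\<^sup>2) + 2 * (\<Sum>k\<in>F. (cmod (c * x (k + n)))\<^sup>2)"
    by (simp only: sum.distrib sum_distrib_left)
  also have "\<dots> \<le> 2 * (ell2_norm x)\<^sup>2 + 2 * (ell2_norm (\<lambda>k. c * x (k + n)))\<^sup>2"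
    using finite_sum_le_ell2_norm[OF assms F] finite_sum_le_ell2_norm[OF y F] by simp
  finally show "(\<Sum>k\<in>F. (cmod (x k - c * x (k + n)))\<^sup>2)
      \<le> 2 * (ell2_norm x)\<^sup>2 + 2 * (ell2_norm (\<lambda>k. c * x (k + n)))\<^sup>2" .
qed

text \<open>
  Cauchy--Schwarz with the weights \<open>\<bar>c\<bar>\<^sup>n\<close> split evenly between both factors. This form puts
  the squares \<open>\<bar>f n\<bar>\<^sup>2\<close> on the right, so that it can be summed over coordinates.
\<close>

lemma geometric_Cauchy_Schwarz:
  fixes c :: complex and f :: "nat \<Rightarrow> complex"
  assumes c: "cmod c < 1" and f: "\<And>n. cmod (f n) \<le> B"
  shows "summable (\<lambda>n. c ^ n * f n)"
    and "summable (\<lambda>n. cmod c ^ n * (cmod (f n))\<^sup>2)"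
    and "(cmod (\<Sum>n. c ^ n * f n))\<^sup>2 \<le> (\<Sum>n. cmod c ^ n * (cmod (f n))\<^sup>2) / (1 - cmod c)"
proof -
  let ?r = "cmod c"
  let ?S = "\<Sum>n. ?r ^ n * (cmod (f n))\<^sup>2"
  have g: "summable (\<lambda>n. ?r ^ n)" "(\<Sum>n. ?r ^ n) = 1 / (1 - ?r)"
    using c by (auto simp: summable_geometric suminf_geometric)
  show sq: "summable (\<lambda>n. ?r ^ n * (cmod (f n))\<^sup>2)"
    by (rule summable_comparison_test'[OF summable_mult2[OF g(1), of "B\<^sup>2"], of 0])
       (auto intro!: mult_left_mono power_mono f)
  have abs: "summable (\<lambda>n. norm (c ^ n * f n))"
    by (rule summable_comparison_test'[OF summable_mult2[OF g(1), of B], of 0])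
       (auto simp: norm_mult norm_power intro!: mult_left_mono f)
  then show s: "summable (\<lambda>n. c ^ n * f n)"
    by (rule summable_norm_cancel)
  have "(cmod (\<Sum>n<N. c ^ n * f n))\<^sup>2 \<le> ?S / (1 - ?r)" for N
  proof -
    have "(cmod (\<Sum>n<N. c ^ n * f n))\<^sup>2 \<le> (\<Sum>n<N. sqrt (?r ^ n) * (sqrt (?r ^ n) * cmod (f n)))\<^sup>2"
      by (intro power_mono order_trans[OF norm_sum] sum_mono)
         (auto simp: norm_mult norm_power simp flip: mult.assoc)
    also have "\<dots> \<le> (\<Sum>n<N. (sqrt (?r ^ n))\<^sup>2) * (\<Sum>n<N. (sqrt (?r ^ n) * cmod (f n))\<^sup>2)"
      by (rule Cauchy_Schwarz_ineq_sum)
    also have "\<dots> = (\<Sum>n<N. ?r ^ n) * (\<Sum>n<N. ?r ^ n * (cmod (f n))\<^sup>2)"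
      by (simp add: power_mult_distrib)
    also have "\<dots> \<le> (1 / (1 - ?r)) * ?S"
      using c unfolding g(2)[symmetric]
      by (intro mult_mono sum_le_suminf g sq) (auto intro!: sum_nonneg suminf_nonneg g)
    finally show ?thesis by simp
  qed
  moreover have "(\<lambda>N. (cmod (\<Sum>n<N. c ^ n * f n))\<^sup>2) \<longlonglongrightarrow> (cmod (\<Sum>n. c ^ n * f n))\<^sup>2"
    by (intro tendsto_intros summable_LIMSEQ s)
  ultimately show "(cmod (\<Sum>n. c ^ n * f n))\<^sup>2 \<le> ?S / (1 - ?r)"
    using LIMSEQ_le_const2 by blast
qed

text \<open>
  The Neumann series for the inverse of \<open>1 - c S\<^sup>d\<close>, where \<open>S\<close> is the shift with
  \<open>(S x)\<^sub>k = x\<^bsub>k+1\<^esub>\<close>. An integer \<open>d\<close> covers the shift and its inverse alike.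
\<close>

definition neumann :: "complex \<Rightarrow> int \<Rightarrow> (int \<Rightarrow> complex) \<Rightarrow> (int \<Rightarrow> complex)" where
  "neumann c d x = (\<lambda>k. \<Sum>n. c ^ n * x (k + int n * d))"

lemma summable_neumann:
  assumes "cmod c < 1" "x \<in> ell2"
  shows "summable (\<lambda>n. c ^ n * x (k + int n * d))"
  by (rule geometric_Cauchy_Schwarz(1)[OF assms(1) cmod_le_ell2_norm[OF assms(2)]])

text \<open>
  Summing the pointwise Cauchy--Schwarz bound over a finite set of coordinates, the two sums
  may be exchanged, and every translate of \<open>x\<close> has the norm of \<open>x\<close>.
\<close>

lemma neumann_bounded:
  assumes c: "cmod c < 1" and x: "x \<in> ell2"
  shows "neumann c d x \<in> ell2" "ell2_norm (neumann c d x) \<le> (1 / (1 - cmod c)) * ell2_norm x"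
proof -
  let ?r = "cmod c"
  have bound: "(\<Sum>k\<in>F. (cmod (neumann c d x k))\<^sup>2) \<le> (ell2_norm x / (1 - ?r))\<^sup>2"
    if F: "finite F" for F
  proof -
    have s: "summable (\<lambda>n. ?r ^ n * (cmod (x (k + int n * d)))\<^sup>2)" for k
      by (rule geometric_Cauchy_Schwarz(2)[OF c cmod_le_ell2_norm[OF x]])
    have g: "summable (\<lambda>n. ?r ^ n)" "(\<Sum>n. ?r ^ n) = 1 / (1 - ?r)"
      using c by (auto simp: summable_geometric suminf_geometric)
    have "(\<Sum>k\<in>F. (cmod (neumann c d x k))\<^sup>2)
        \<le> (\<Sum>k\<in>F. (\<Sum>n. ?r ^ n * (cmod (x (k + int n * d)))\<^sup>2) / (1 - ?r))"
      unfolding neumann_def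
      by (intro sum_mono geometric_Cauchy_Schwarz(3)[OF c cmod_le_ell2_norm[OF x]])
    also have "\<dots> = (\<Sum>n. \<Sum>k\<in>F. ?r ^ n * (cmod (x (k + int n * d)))\<^sup>2) / (1 - ?r)"
      by (simp add: suminf_sum[OF s] flip: sum_divide_distrib)
    also have "\<dots> \<le> (\<Sum>n. ?r ^ n * (ell2_norm x)\<^sup>2) / (1 - ?r)"
    proof (intro divide_right_mono suminf_le summable_sum s summable_mult2 g)
      fix n
      have "(\<Sum>k\<in>F. (cmod (x (k + int n * d)))\<^sup>2) \<le> (ell2_norm x)\<^sup>2"
        using finite_sum_le_ell2_norm[OF ell2_translate(1)[OF x] F] ell2_translate(2)[OF x]
        by metis
      then show "(\<Sum>k\<in>F. ?r ^ n * (cmod (x (k + int n * d)))\<^sup>2) \<le> ?r ^ n * (ell2_norm x)\<^sup>2"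
        by (simp add: mult_left_mono flip: sum_distrib_left)
    qed (use c in auto)
    also have "\<dots> = (ell2_norm x / (1 - ?r))\<^sup>2"
      using suminf_mult2[OF g(1), of "(ell2_norm x)\<^sup>2"]
      by (simp add: g(2) power2_eq_square)
    finally show ?thesis .
  qed
  show "neumann c d x \<in> ell2"
    by (rule ell2_of_finite_sums(1)) (rule bound)
  have "(ell2_norm (neumann c d x))\<^sup>2 \<le> (ell2_norm x / (1 - ?r))\<^sup>2"
    by (rule ell2_of_finite_sums(2)) (rule bound)
  then show "ell2_norm (neumann c d x) \<le> (1 / (1 - ?r)) * ell2_norm x"
    using c by (auto simp: ell2_norm_def infsum_nonneg intro: power2_le_imp_le)
qed

text \<open>
  Splitting off the first term of the series gives \<open>N x = x + c S\<^sup>d N x\<close>, and \<open>N\<close> commutes with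
  \<open>S\<^sup>d\<close>; hence \<open>N\<close> inverts on both sides.
\<close>

lemma ell2_invertible_one_minus_translate:
  assumes c: "cmod c < 1"
  shows "ell2_invertible (\<lambda>x k. x k - c * x (k + d))"
  unfolding ell2_invertible_def
proof (intro exI conjI ballI)
  have shift: "neumann c d x k = x k + c * neumann c d x (k + d)" if "x \<in> ell2" for x k
  proof -
    have "neumann c d x k = x k + (\<Sum>n. c ^ Suc n * x (k + int (Suc n) * d))"
      unfolding neumann_def using suminf_split_head[OF summable_neumann[OF c that, of k d]] by simp
    also have "(\<Sum>n. c ^ Suc n * x (k + int (Suc n) * d))
        = (\<Sum>n. c * (c ^ n * x (k + d + int n * d)))"
      by (simp add: algebra_simps)
    also have "\<dots> = c * neumann c d x (k + d)"
      unfolding neumann_def by (rule suminf_mult[OF summable_neumann[OF c that]])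
    finally show ?thesis .
  qed
  have add: "neumann c d (\<lambda>k. x k + y k) = (\<lambda>k. neumann c d x k + neumann c d y k)"
    if "x \<in> ell2" "y \<in> ell2" for x y
    unfolding neumann_def
    by (simp add: suminf_add[OF summable_neumann[OF c that(1)] summable_neumann[OF c that(2)]]
        distrib_left)
  have scale: "neumann c d (\<lambda>k. a * x k) = (\<lambda>k. a * neumann c d x k)" if "x \<in> ell2" for a x
    unfolding neumann_def
    by (subst suminf_mult[OF summable_neumann[OF c that], symmetric]) (simp add: mult.left_commute)
  show "bounded_operator (neumann c d)"
    unfolding bounded_operator_def using neumann_bounded[OF c] add scale by blast
  fix x assume x: "x \<in> ell2"
  show "(\<lambda>k. neumann c d x k - c * neumann c d x (k + d)) = x"
    by (rule ext, subst shift[OF x]) simp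
  have t: "(\<lambda>k. x (k + d)) \<in> ell2" "(\<lambda>k. - c * x (k + d)) \<in> ell2"
    using ell2_translate(1)[OF x] ell2_scale(1)[OF ell2_translate(1)[OF x]] by blast+
  have "neumann c d (\<lambda>k. x k + - c * x (k + d))
      = (\<lambda>k. neumann c d x k + - c * neumann c d (\<lambda>k. x (k + d)) k)"
    using add[OF x t(2)] scale[OF t(1), of "- c"] by simp
  also have "neumann c d (\<lambda>k. x (k + d)) = (\<lambda>k. neumann c d x (k + d))"
    by (simp add: neumann_def algebra_simps)
  also have "(\<lambda>k. neumann c d x k + - c * neumann c d x (k + d)) = x"
    by (rule ext, subst shift[OF x]) simp
  finally show "neumann c d (\<lambda>k. x k - c * x (k + d)) = x"
    by simp
qed

text \<open>
  The Neumann series needs a coefficient inside the unit disc: write \<open>S - c\<close> as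
  \<open>S (1 - c S\<inverse>)\<close> for \<open>\<bar>c\<bar> < 1\<close> and as \<open>- c (1 - c\<inverse> S)\<close> for \<open>\<bar>c\<bar> > 1\<close>.
\<close>

lemma ell2_invertible_translate_minus:
  assumes "cmod c \<noteq> 1"
  shows "ell2_invertible (\<lambda>x k. x (k + 1) - c * x k)"
proof (cases "cmod c < 1")
  case True
  have "ell2_invertible (\<lambda>x. (\<lambda>y k. y (k + 1)) ((\<lambda>x k. x k - c * x (k + (-1))) x))"
    by (rule ell2_invertible_comp[OF ell2_invertible_translate _
          ell2_invertible_one_minus_translate[OF True]])
       (erule ell2_diff_translate ell2_translate(1))+
  then show ?thesis by simp
next
  case False
  then have c: "cmod (inverse c) < 1" "c \<noteq> 0"
    using assms by (auto simp: norm_inverse inverse_less_1_iff)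
  have "ell2_invertible (\<lambda>x. (\<lambda>y k. - c * y k) ((\<lambda>x k. x k - inverse c * x (k + 1)) x))"
    by (rule ell2_invertible_comp[OF ell2_invertible_scale _
          ell2_invertible_one_minus_translate[OF c(1)]])
       (use c in \<open>auto intro: ell2_diff_translate ell2_scale(1)[of _ "- c", simplified]\<close>)
  then show ?thesis using c by (simp add: right_diff_distrib flip: mult.assoc)
qed

text \<open>
  Let \<open>l\<close> and \<open>m\<close> be the roots of \<open>t\<^sup>2 - w t + a\<close>. If one of them, \<open>u\<close>, had modulus one, the
  other would be \<open>a / u = a * cnj u\<close>, and their sum \<open>w\<close> would lie on the curve. So off the curve
  \<open>S\<inverse> (S - l) (S - m)\<close> is a product of invertible factors.
\<close>

lemma spectrum_constant_tridiag_subset: "spectrum (tridiag (\<lambda>_. a)) \<subseteq> symbol_curve a"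
proof
  fix w assume w: "w \<in> spectrum (tridiag (\<lambda>_. a))"
  show "w \<in> symbol_curve a"
  proof (rule ccontr)
    assume not: "w \<notin> symbol_curve a"
    define l m where "l = (w + csqrt (w\<^sup>2 - 4 * a)) / 2" and "m = (w - csqrt (w\<^sup>2 - 4 * a)) / 2"
    have sum: "l + m = w" by (simp add: l_def m_def field_simps)
    have "l * m = (w\<^sup>2 - (csqrt (w\<^sup>2 - 4 * a))\<^sup>2) / 4"
      by (simp add: l_def m_def power2_eq_square algebra_simps)
    then have prod: "l * m = a" by simp
    have "cmod u \<noteq> 1" if "u + v = w" "u * v = a" for u v
    proof
      assume u: "cmod u = 1"
      then have "u * cnj u = 1" by (simp add: complex_norm_square[symmetric])
      then have "a * cnj u = v"
        using that(2) by (metis mult.commute mult.left_commute mult_1)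
      then have "w = u + a * cnj u" using that(1) by simp
      then show False
        using not u by (auto simp: symbol_curve_def)
    qed
    from this[of l m] this[of m l] have lm: "cmod l \<noteq> 1" "cmod m \<noteq> 1"
      using sum prod by (auto simp: add.commute mult.commute)
    define D :: "complex \<Rightarrow> (int \<Rightarrow> complex) \<Rightarrow> (int \<Rightarrow> complex)"
      where "D = (\<lambda>c x k. x (k + 1) - c * x k)"
    have D: "D c x \<in> ell2" if "x \<in> ell2" for c x
      using ell2_translate(1)[OF ell2_diff_translate[OF that, of c "-1"], of 1]
      by (simp add: D_def)
    have inv: "ell2_invertible (D l)" "ell2_invertible (D m)"
      using lm ell2_invertible_translate_minus by (auto simp: D_def)
    have "ell2_invertible (\<lambda>x k. D l (D m x) (k + (-1)))"
      by (rule ell2_invertible_comp[OF ell2_invertible_translate ell2_translate(1)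
            ell2_invertible_comp[OF inv(1) D inv(2) D]]) (auto intro: D)
    moreover have "(\<lambda>x k. D l (D m x) (k + (-1))) = (\<lambda>x k. tridiag (\<lambda>_. a) x k - w * x k)"
      by (simp add: D_def fun_eq_iff tridiag_def algebra_simps flip: sum prod)
    ultimately show False
      using w by (simp add: spectrum_iff_not_invertible)
  qed
qed

text \<open>
  The plane wave \<open>z\<^sup>k\<close> solves the eigenvalue equation at every coordinate. Cut off to
  \<open>[0, n)\<close> it has squared norm \<open>n\<close>, while the defect \<open>y\<close> lives on the four coordinates next to
  the ends and is bounded independently of \<open>n\<close>; this excludes a bounded inverse.
\<close>

lemma symbol_curve_subset_spectrum: "symbol_curve a \<subseteq> spectrum (tridiag (\<lambda>_. a))"
proof
  fix w assume "w \<in> symbol_curve a"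
  then obtain z where z: "cmod z = 1" and w: "w = z + a * cnj z"
    by (auto simp: symbol_curve_def)
  have z0: "z \<noteq> 0" using z by auto
  have cnj: "cnj z = inverse z"
    by (rule inverse_unique[symmetric]) (use z in \<open>simp add: complex_norm_square[symmetric]\<close>)
  show "w \<in> spectrum (tridiag (\<lambda>_. a))"
  proof (rule ccontr)
    assume "w \<notin> spectrum (tridiag (\<lambda>_. a))"
    then obtain R where R: "bounded_operator R"
      "\<And>x. x \<in> ell2 \<Longrightarrow> R (\<lambda>k. tridiag (\<lambda>_. a) x k - w * x k) = x"
      unfolding spectrum_def by blast
    obtain C where C: "\<And>y. y \<in> ell2 \<Longrightarrow> ell2_norm (R y) \<le> C * ell2_norm y"
      using R(1) unfolding bounded_operator_def by blast
    obtain n :: nat where n: "C\<^sup>2 * (4 * (1 + cmod a)\<^sup>2) < real n"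
      using reals_Archimedean2 by blast
    let ?I = "{0..<int n}"
    define x where "x = (\<lambda>k. if k \<in> ?I then z powi k else 0)"
    define y where "y = (\<lambda>k. tridiag (\<lambda>_. a) x k - w * x k)"
    have "x k = 0" if "k \<notin> ?I" for k
      using that by (auto simp: x_def)
    note x = finitely_supported_ell2[of ?I x, OF finite_atLeastLessThan_int this]
    then have nx: "(ell2_norm x)\<^sup>2 = real n"
      by (simp add: x_def norm_power_int z)
    let ?J = "{-1, 0, int n - 1, int n}"
    \<comment> \<open>Subtracting the eigenvalue equation of the full wave leaves only the neighbours
      on which the truncated and the full wave differ.\<close>
    have y_eq: "y k = a * (x (k - 1) - (if k \<in> ?I then z powi (k - 1) else 0))
        + (x (k + 1) - (if k \<in> ?I then z powi (k + 1) else 0))" for k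
    proof -
      have "w * z powi k = z powi (k + 1) + a * z powi (k - 1)"
        using z0 by (simp add: w cnj power_int_add power_int_diff distrib_left divide_inverse
            mult.commute mult.left_commute)
      then have "w * x k = (if k \<in> ?I then z powi (k + 1) + a * z powi (k - 1) else 0)"
        by (simp add: x_def)
      then show ?thesis
        by (simp add: y_def tridiag_def right_diff_distrib)
    qed
    have y0: "y k = 0" if "k \<notin> ?J" for k
    proof -
      have "k - 1 \<in> ?I \<longleftrightarrow> k \<in> ?I" "k + 1 \<in> ?I \<longleftrightarrow> k \<in> ?I"
        using that by auto
      then show ?thesis by (simp only: y_eq x_def) simp
    qed
    have y1: "cmod (y k) \<le> 1 + cmod a" for k
    proof -
      let ?u = "x (k - 1) - (if k \<in> ?I then z powi (k - 1) else 0)"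
      let ?v = "x (k + 1) - (if k \<in> ?I then z powi (k + 1) else 0)"
      have "cmod ?u \<le> 1" "cmod ?v \<le> 1"
        by (auto simp: x_def norm_power_int norm_inverse z)
      then have "cmod (a * ?u) + cmod ?v \<le> cmod a + 1"
        unfolding norm_mult by (intro add_mono mult_left_le) auto
      then show ?thesis
        using norm_triangle_ineq[of "a * ?u" ?v] unfolding y_eq by linarith
    qed
    have "finite ?J" by simp
    note y = finitely_supported_ell2[of ?J y, OF this y0]
    have "(\<Sum>k\<in>?J. (cmod (y k))\<^sup>2) \<le> of_nat (card ?J) * (1 + cmod a)\<^sup>2"
      by (rule sum_bounded_above) (intro power_mono y1 norm_ge_zero)
    also have "\<dots> \<le> 4 * (1 + cmod a)\<^sup>2"
    proof (rule mult_right_mono)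
      have "card (set [-1, 0, int n - 1, int n]) \<le> length [-1, 0, int n - 1, int n]"
        by (rule card_length)
      then show "real (card ?J) \<le> 4" by simp
    qed simp
    finally have ny: "(ell2_norm y)\<^sup>2 \<le> 4 * (1 + cmod a)\<^sup>2"
      using y(2) by simp
    have "ell2_norm x \<le> C * ell2_norm y"
      using C[OF y(1)] R(2)[OF x(1)] by (simp add: y_def)
    then have "(ell2_norm x)\<^sup>2 \<le> (C * ell2_norm y)\<^sup>2"
      by (rule power_mono) (simp add: ell2_norm_def infsum_nonneg)
    also have "\<dots> \<le> C\<^sup>2 * (4 * (1 + cmod a)\<^sup>2)"
      unfolding power_mult_distrib by (rule mult_left_mono[OF ny]) simp
    finally show False
      using n nx by simp
  qed
qed

theorem corollary3p7:
  fixes A :: "complex set" and b :: "int \<Rightarrow> complex"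
  assumes "finite A"
    and "range b \<subseteq> A"
    and "\<forall>a\<in>A. (\<lambda>_. a) \<in> subshift A b"
  shows "closure (numerical_range (tridiag b))
           = convex hull (\<Union>a\<in>A. closure (numerical_range (tridiag (\<lambda>_. a))))
       \<and> convex hull (\<Union>a\<in>A. closure (numerical_range (tridiag (\<lambda>_. a))))
           = convex hull (\<Union>a\<in>A. spectrum (tridiag (\<lambda>_. a)))"
proof -
  have const: "closure (numerical_range (tridiag (\<lambda>_. a))) = convex hull symbol_curve a" for a
    using closure_numerical_range_eq[of "{a}" "\<lambda>_. a"] by simp
  have spec: "spectrum (tridiag (\<lambda>_. a)) = symbol_curve a" for a
    using spectrum_constant_tridiag_subset symbol_curve_subset_spectrum by blast
  have "closure (numerical_range (tridiag b)) = convex hull (\<Union>a\<in>A. symbol_curve a)"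
    by (rule closure_numerical_range_eq[OF assms(1,2)
          long_block_of_constant_in_subshift[OF bspec[OF assms(3)]]])
  moreover have "convex hull (\<Union>a\<in>A. convex hull symbol_curve a)
      = convex hull (\<Union>a\<in>A. symbol_curve a)"
  proof (rule antisym)
    show "convex hull (\<Union>a\<in>A. convex hull symbol_curve a)
        \<subseteq> convex hull (\<Union>a\<in>A. symbol_curve a)"
      by (intro hull_minimal UN_least convex_convex_hull hull_mono) blast
    show "convex hull (\<Union>a\<in>A. symbol_curve a)
        \<subseteq> convex hull (\<Union>a\<in>A. convex hull symbol_curve a)"
      by (intro hull_mono UN_mono hull_subset order_refl)
  qed
  ultimately show ?thesis
    by (simp add: const spec)
qed

end
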